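(* Let $G$ be a finite simple graph on a vertex set $V$ with independence complex $\mathrm{Ind}(G)$, and let $S \subseteq V$, with $\overline{S} = V \setminus S$. Then $\mathrm{Ind}(G \cup W(S))$ is vertex decomposable if and only if $\mathrm{Ind}((G \setminus N[\mu])|_{\overline{S}})$ is vertex decomposable for all $\mu \in \mathrm{Ind}(G)$ with $\mu \subseteq S$ (including $\mu=\emptyset$).
   Context: For a finite simple graph $G=(V,E)$, a subset $U \subseteq V$ is independent if no edge $e\in E$ is contained in $U$; the independence complex $\mathrm{Ind}(G)$ is the simplicial complex of all independent sets of $G$ (including $\emptyset$; for the graph with no vertices it is $\{\emptyset\}$). $G \cup W(S)$ is the graph obtained from $G$ by adding a whisker to every vertex of $S$: for each $x \in S$ add a new vertex $y_x$ (distinct for distinct $x$) and the single edge $\{x,y_x\}$. For $\mu \subseteq V$, $N[\mu] = \mu \cup \{x \in V : x \text{ is adjacent to some } y \in \mu\}$ is the closed neighborhood. $G \setminus N[\mu]$ is $G$ with the vertices of $N[\mu]$ and all edges incident to them removed. $(G\setminus N[\mu])|_{\overline{S}}$ is the induced subgraph of $G \setminus N[\mu]$ on those of its vertices lying in $\overline{S}$, i.e. the induced subgraph of $G$ on $\overline{S} \setminus N[\mu]$. Simplicial complexes: facets are the maximal faces under inclusion; a simplex is a complex having exactly one facet (the complex $\{\emptyset\}$ counts as a simplex). For a vertex $v$ with $\{v\}\in\Delta$, $\Delta \setminus v = \{\tau \in \Delta : v \notin \tau\}$ and $\mathrm{link}_\Delta(v) = \{\tau \in \Delta : v \notin \tau,\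 \tau \cup \{v\} \in \Delta\}$. Vertex decomposable (non-pure sense), defined recursively: $\Delta$ is vertex decomposable if either $\Delta$ is a simplex, or there is a vertex $v$ (with $\{v\}\in\Delta$) such that $\Delta \setminus v$ and $\mathrm{link}_\Delta(v)$ are both vertex decomposable and have no facet in common. *)

theory Defs
  imports Main
begin

section \<open>Finite simple graphs\<close>

record 'a sgraph =
  verts :: "'a set"
  edges :: "'a set set"

definition fin_simple_graph :: "'a sgraph \<Rightarrow> bool" where
  "fin_simple_graph G \<longleftrightarrow>
     finite (verts G) \<and> (\<forall>e\<in>edges G. e \<subseteq> verts G \<and> card e = 2)"

definition Ind :: "'a sgraph \<Rightarrow> 'a set set" where
  "Ind G = {U. U \<subseteq> verts G \<and> (\<forall>e\<in>edges G. \<not> e \<subseteq> U)}"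

text \<open>The vertices of \<open>whisker G S\<close> live in a sum type: \<open>Inl x\<close> is the vertex \<open>x\<close> of \<open>G\<close>, and
  \<open>Inr x\<close> (for \<open>x \<in> S\<close>) is the new end point \<open>y\<^sub>x\<close> of the whisker at \<open>x\<close>. This makes the new
  vertices distinct from each other and from those of \<open>G\<close>.\<close>

definition whisker :: "'a sgraph \<Rightarrow> 'a set \<Rightarrow> ('a + 'a) sgraph" where
  "whisker G S =
     \<lparr>verts = Inl ` verts G \<union> Inr ` S,
      edges = (\<lambda>e. Inl ` e) ` edges G \<union> (\<lambda>x. {Inl x, Inr x}) ` S\<rparr>"

definition closed_nbhd :: "'a sgraph \<Rightarrow> 'a set \<Rightarrow> 'a set" where
  "closed_nbhd G \<mu> = \<mu> \<union> {x \<in> verts G. \<exists>y\<in>\<mu>. {x, y} \<in> edges G}"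

definition delete_verts :: "'a sgraph \<Rightarrow> 'a set \<Rightarrow> 'a sgraph" where
  "delete_verts G W =
     \<lparr>verts = verts G - W, edges = {e \<in> edges G. e \<inter> W = {}}\<rparr>"

text \<open>In \<open>induced_subgraph G A\<close> the set \<open>A\<close> need not consist of vertices of \<open>G\<close>; the subgraph is
  the one induced on those vertices of \<open>G\<close> that lie in \<open>A\<close>.\<close>

definition induced_subgraph :: "'a sgraph \<Rightarrow> 'a set \<Rightarrow> 'a sgraph" where
  "induced_subgraph G A =
     \<lparr>verts = verts G \<inter> A, edges = {e \<in> edges G. e \<subseteq> verts G \<inter> A}\<rparr>"

section \<open>Vertex decomposable simplicial complexes\<close>

text \<open>A complex is given by its set of faces and always contains the empty face, so the void
  complex without any faces is excluded.\<close>

definition simplicial_complex :: "'a set set \<Rightarrow> bool" where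
  "simplicial_complex \<Delta> \<longleftrightarrow>
     finite \<Delta> \<and> {} \<in> \<Delta> \<and> (\<forall>\<tau>\<in>\<Delta>. \<forall>\<sigma>. \<sigma> \<subseteq> \<tau> \<longrightarrow> \<sigma> \<in> \<Delta>)"

definition facets :: "'a set set \<Rightarrow> 'a set set" where
  "facets \<Delta> = {\<sigma> \<in> \<Delta>. \<forall>\<tau>\<in>\<Delta>. \<sigma> \<subseteq> \<tau> \<longrightarrow> \<tau> = \<sigma>}"

definition is_simplex :: "'a set set \<Rightarrow> bool" where
  "is_simplex \<Delta> \<longleftrightarrow> simplicial_complex \<Delta> \<and> (\<exists>!\<sigma>. \<sigma> \<in> facets \<Delta>)"

definition deletion :: "'a set set \<Rightarrow> 'a \<Rightarrow> 'a set set" where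
  "deletion \<Delta> v = {\<tau> \<in> \<Delta>. v \<notin> \<tau>}"

definition link :: "'a set set \<Rightarrow> 'a \<Rightarrow> 'a set set" where
  "link \<Delta> v = {\<tau> \<in> \<Delta>. v \<notin> \<tau> \<and> \<tau> \<union> {v} \<in> \<Delta>}"

inductive vertex_decomposable :: "'a set set \<Rightarrow> bool" where
  simplex: "is_simplex \<Delta> \<Longrightarrow> vertex_decomposable \<Delta>"
| shedding:
    "\<lbrakk>simplicial_complex \<Delta>; {v} \<in> \<Delta>;
      vertex_decomposable (deletion \<Delta> v); vertex_decomposable (link \<Delta> v);
      facets (deletion \<Delta> v) \<inter> facets (link \<Delta> v) = {}\<rbrakk>
     \<Longrightarrow> vertex_decomposable \<Delta>"

lemma simplicial_complex_Ind:
  assumes "fin_simple_graph G"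
  shows "simplicial_complex (Ind G)"
proof -
  have "finite (Ind G)"
    by (rule finite_subset[of _ "Pow (verts G)"])
      (use assms in \<open>auto simp: Ind_def fin_simple_graph_def\<close>)
  moreover have "{} \<in> Ind G"
    using assms by (auto simp: Ind_def fin_simple_graph_def)
  moreover have "\<sigma> \<in> Ind G" if "\<tau> \<in> Ind G" "\<sigma> \<subseteq> \<tau>" for \<sigma> \<tau>
    using that unfolding Ind_def by blast
  ultimately show ?thesis
    unfolding simplicial_complex_def by blast
qed

lemma fin_simple_graph_whisker:
  assumes "fin_simple_graph G" "S \<subseteq> verts G"
  shows "fin_simple_graph (whisker G S)"
  using assms finite_subset[of S "verts G"]
  by (auto simp: fin_simple_graph_def whisker_def card_image)

lemma fin_simple_graph_delete_verts:
  "fin_simple_graph G \<Longrightarrow> fin_simple_graph (delete_verts G W)"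
  by (auto simp: fin_simple_graph_def delete_verts_def)

lemma fin_simple_graph_induced_subgraph:
  "fin_simple_graph G \<Longrightarrow> fin_simple_graph (induced_subgraph G A)"
  by (auto simp: fin_simple_graph_def induced_subgraph_def)

end

theory Submission
  imports Defs
begin

text \<open>Both directions hold for an arbitrary simplicial complex \<open>\<Delta>\<close> in place of \<open>Ind G\<close>: whiskering
  adds for every \<open>x \<in> S\<close> a vertex \<open>y\<^sub>x\<close> that is incompatible only with \<open>x\<close>. For
  \<open>\<mu> \<in> \<Delta>\<close> with \<open>\<mu> \<subseteq> S\<close>, the link of the face \<open>\<mu> \<union> {y\<^sub>x | x \<in> S - \<mu>}\<close> of the whiskered complex
  consists of the \<open>\<tau>\<close> outside \<open>S\<close> with \<open>\<tau> \<union> \<mu> \<in> \<Delta>\<close>, and links inherit vertex decomposability.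
  Conversely, every vertex \<open>x \<in> S\<close> of \<open>\<Delta>\<close> is a shedding vertex of the whiskered complex, because its deletion is
  a cone with apex \<open>y\<^sub>x\<close> while \<open>y\<^sub>x\<close> is not in its link; both are governed by whiskered complexes over
  \<open>S - {x}\<close>, so induction on \<open>S\<close> applies.\<close>

section \<open>Simplicial complexes\<close>

lemma simplicial_complexD:
  assumes "simplicial_complex \<Delta>"
  shows "finite \<Delta>" "{} \<in> \<Delta>" "\<tau> \<in> \<Delta> \<Longrightarrow> \<sigma> \<subseteq> \<tau> \<Longrightarrow> \<sigma> \<in> \<Delta>"
  using assms by (auto simp: simplicial_complex_def)

text \<open>Only the set of faces is assumed finite; all subsets of a face are faces, so the face
  itself is finite.\<close>

lemma finite_face:
  assumes "simplicial_complex \<Delta>" "\<tau> \<in> \<Delta>"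
  shows "finite \<tau>"
proof -
  have "Pow \<tau> \<subseteq> \<Delta>"
    using simplicial_complexD(3)[OF assms] by blast
  then show ?thesis
    using simplicial_complexD(1)[OF assms(1)] finite_subset finite_Pow_iff by blast
qed

lemma face_subset_facet:
  assumes "finite \<Delta>" "\<tau> \<in> \<Delta>"
  obtains \<sigma> where "\<sigma> \<in> facets \<Delta>" "\<tau> \<subseteq> \<sigma>"
proof -
  obtain \<sigma> where "\<sigma> \<in> \<Delta>" "\<tau> \<subseteq> \<sigma>" "\<forall>\<rho>\<in>\<Delta>. \<sigma> \<subseteq> \<rho> \<longrightarrow> \<sigma> = \<rho>"
    using finite_has_maximal2[OF assms] by blast
  then show ?thesis
    by (intro that[of \<sigma>]) (auto simp: facets_def)
qed

text \<open>In a finite complex every face extends to a facet, so a unique facet contains all faces.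
  The power set form serves the base cases of the inductions below.\<close>

lemma is_simplex_iff: "is_simplex \<Delta> \<longleftrightarrow> (\<exists>\<sigma>. finite \<sigma> \<and> \<Delta> = Pow \<sigma>)"
proof
  assume "is_simplex \<Delta>"
  then obtain \<sigma> where sc: "simplicial_complex \<Delta>" and \<sigma>: "\<sigma> \<in> facets \<Delta>"
    and uniq: "\<And>\<tau>. \<tau> \<in> facets \<Delta> \<Longrightarrow> \<tau> = \<sigma>"
    unfolding is_simplex_def by blast
  have "\<sigma> \<in> \<Delta>"
    using \<sigma> by (simp add: facets_def)
  moreover have "\<tau> \<subseteq> \<sigma>" if "\<tau> \<in> \<Delta>" for \<tau>
    using face_subset_facet[OF simplicial_complexD(1)[OF sc] that] uniq by metis
  ultimately have "\<Delta> = Pow \<sigma>"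
    using simplicial_complexD(3)[OF sc] by blast
  then show "\<exists>\<sigma>. finite \<sigma> \<and> \<Delta> = Pow \<sigma>"
    using finite_face[OF sc \<open>\<sigma> \<in> \<Delta>\<close>] by blast
next
  assume "\<exists>\<sigma>. finite \<sigma> \<and> \<Delta> = Pow \<sigma>"
  then obtain \<sigma> where "finite \<sigma>" "\<Delta> = Pow \<sigma>"
    by blast
  moreover have "facets (Pow \<sigma>) = {\<sigma>}"
    by (auto simp: facets_def)
  ultimately show "is_simplex \<Delta>"
    by (auto simp: is_simplex_def simplicial_complex_def)
qed

lemma simplicial_complex_deletion:
  "simplicial_complex \<Delta> \<Longrightarrow> simplicial_complex (deletion \<Delta> v)"
  unfolding simplicial_complex_def deletion_def by auto

lemma simplicial_complex_link:
  assumes "simplicial_complex \<Delta>" "{v} \<in> \<Delta>"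
  shows "simplicial_complex (link \<Delta> v)"
proof -
  have "\<sigma> \<in> link \<Delta> v" if "\<tau> \<in> link \<Delta> v" "\<sigma> \<subseteq> \<tau>" for \<sigma> \<tau>
  proof -
    have "\<sigma> \<union> {v} \<subseteq> \<tau> \<union> {v}"
      using that(2) by blast
    then show ?thesis
      using that simplicial_complexD(3)[OF assms(1)] unfolding link_def by blast
  qed
  moreover have "{} \<in> link \<Delta> v"
    using assms simplicial_complexD(2) by (auto simp: link_def)
  moreover have "finite (link \<Delta> v)"
    using simplicial_complexD(1)[OF assms(1)] by (simp add: link_def)
  ultimately show ?thesis
    by (auto simp: simplicial_complex_def)
qed

lemma vertex_decomposable_imp_simplicial_complex:
  "vertex_decomposable \<Delta> \<Longrightarrow> simplicial_complex \<Delta>"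
  by (induction rule: vertex_decomposable.induct) (auto simp: is_simplex_def)

section \<open>Links, cones and relabellings\<close>

text \<open>Removing \<open>w\<close> from a face above \<open>insert w \<sigma>\<close> gives a
  face of the link above \<sigma>, so maximality in the link carries over. This turns a common facet
  of two links into a common facet of the two complexes.\<close>

lemma facets_link_insert:
  assumes "simplicial_complex \<Delta>" "\<sigma> \<in> facets (link \<Delta> w)"
  shows "insert w \<sigma> \<in> facets \<Delta>"
proof -
  have \<sigma>: "w \<notin> \<sigma>" "insert w \<sigma> \<in> \<Delta>"
    and max: "\<And>\<tau>. \<tau> \<in> link \<Delta> w \<Longrightarrow> \<sigma> \<subseteq> \<tau> \<Longrightarrow> \<tau> = \<sigma>"
    using assms(2) by (auto simp: facets_def link_def)
  have "\<tau> = insert w \<sigma>" if "\<tau> \<in> \<Delta>" "insert w \<sigma> \<subseteq> \<tau>" for \<tau>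
  proof -
    have "\<tau> - {w} \<union> {w} = \<tau>"
      using that(2) by blast
    then have "\<tau> - {w} \<in> link \<Delta> w"
      using simplicial_complexD(3)[OF assms(1) that(1)] that(1) by (auto simp: link_def)
    then have "\<tau> - {w} = \<sigma>"
      using max that(2) \<sigma>(1) by blast
    then show ?thesis
      using that(2) by blast
  qed
  then show ?thesis
    using \<sigma>(2) unfolding facets_def by blast
qed

text \<open>The link at \<open>w\<close> sheds the same vertices as \<Delta>, in the same order,
  skipping those that are not vertices of the link and stopping the recursion when \<open>w\<close>
  itself is shed.\<close>

lemma vertex_decomposable_link:
  assumes "vertex_decomposable \<Delta>" "{w} \<in> \<Delta>"
  shows "vertex_decomposable (link \<Delta> w)"
  using assms
proof (induction rule: vertex_decomposable.induct)
  case (simplex \<Delta>)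
  then obtain \<sigma> where \<sigma>: "finite \<sigma>" "\<Delta> = Pow \<sigma>"
    by (auto simp: is_simplex_iff)
  then have "link \<Delta> w = Pow (\<sigma> - {w})"
    using simplex.prems by (auto simp: link_def)
  then show ?case
    using \<sigma>(1) by (intro vertex_decomposable.simplex) (auto simp: is_simplex_iff)
next
  case (shedding \<Delta> v)
  note sc = shedding.hyps(1)
  consider "w = v" | "w \<noteq> v" "{v, w} \<notin> \<Delta>" | "w \<noteq> v" "{v, w} \<in> \<Delta>"
    by blast
  then show ?case
  proof cases
    case 1
    then show ?thesis
      using shedding.hyps by simp
  next
    case 2
    have "v \<notin> \<tau>" if "\<tau> \<in> link \<Delta> w" for \<tau>
      using that 2(2) simplicial_complexD(3)[OF sc, of "\<tau> \<union> {w}" "{v, w}"]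
      by (auto simp: link_def)
    \<comment> \<open>As \<Delta> has no face with both vertices, deleting \<open>v\<close> first
      does not affect the link at \<open>w\<close>.\<close>
    then have "link \<Delta> w = link (deletion \<Delta> v) w"
      using 2(1) by (auto simp: link_def deletion_def)
    then show ?thesis
      using shedding 2 by (auto simp: deletion_def)
  next
    case 3
    have v: "{v} \<in> link \<Delta> w"
      using 3 shedding.hyps(2) by (auto simp: link_def insert_commute)
    have w: "{w} \<in> deletion \<Delta> v" "{w} \<in> link \<Delta> v"
      using 3 shedding.prems by (auto simp: link_def deletion_def insert_commute)
    have del: "deletion (link \<Delta> w) v = link (deletion \<Delta> v) w"
      using 3 by (auto simp: link_def deletion_def)
    have "\<tau> \<in> link (link \<Delta> w) v \<longleftrightarrow> \<tau> \<in> link (link \<Delta> v) w" for \<tau>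
      using 3(1) simplicial_complexD(3)[OF sc, of "insert v (insert w \<tau>)"]
      by (auto simp: link_def insert_commute)
    then have lk: "link (link \<Delta> w) v = link (link \<Delta> v) w"
      by blast
    \<comment> \<open>Adding \<open>w\<close> to a common facet would give a common facet of
      \<open>deletion \<Delta> v\<close> and \<open>link \<Delta> v\<close>.\<close>
    have "facets (link (deletion \<Delta> v) w) \<inter> facets (link (link \<Delta> v) w) = {}"
      using facets_link_insert[OF simplicial_complex_deletion[OF sc], of _ v w]
        facets_link_insert[OF simplicial_complex_link[OF sc shedding.hyps(2)], of _ w]
        shedding.hyps(5) by blast
    then show ?thesis
      using vertex_decomposable.shedding[OF simplicial_complex_link[OF sc shedding.prems] v]
        shedding.IH w del lk by simp
  qed
qed

definition face_link :: "'a set set \<Rightarrow> 'a set \<Rightarrow> 'a set set" where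
  "face_link \<Delta> \<sigma> = {\<tau> \<in> \<Delta>. \<tau> \<inter> \<sigma> = {} \<and> \<tau> \<union> \<sigma> \<in> \<Delta>}"

text \<open>The link of a face is an iterated vertex link, taken at one vertex of the face after
  another.\<close>

lemma vertex_decomposable_face_link:
  assumes "vertex_decomposable \<Delta>" "\<sigma> \<in> \<Delta>"
  shows "vertex_decomposable (face_link \<Delta> \<sigma>)"
proof -
  have sc: "simplicial_complex \<Delta>"
    using assms(1) by (rule vertex_decomposable_imp_simplicial_complex)
  have "finite \<sigma>"
    using finite_face[OF sc assms(2)] .
  then show ?thesis
    using assms(2)
  proof (induction \<sigma> rule: finite_induct)
    case empty
    then show ?case
      using assms(1) by (simp add: face_link_def)
  next
    case (insert w \<sigma>)
    have "\<tau> \<in> face_link \<Delta> (insert w \<sigma>) \<longleftrightarrow> \<tau> \<in> link (face_link \<Delta> \<sigma>) w" for \<tau>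
      using insert.hyps(2) simplicial_complexD(3)[OF sc, of "insert w (\<tau> \<union> \<sigma>)"]
      by (auto simp: link_def face_link_def)
    then have "face_link \<Delta> (insert w \<sigma>) = link (face_link \<Delta> \<sigma>) w"
      by blast
    moreover have "\<sigma> \<in> \<Delta>" "{w} \<in> face_link \<Delta> \<sigma>"
      using insert.prems insert.hyps(2) simplicial_complexD(3)[OF sc insert.prems]
      by (auto simp: face_link_def)
    ultimately show ?case
      using vertex_decomposable_link insert.IH by metis
  qed
qed

section \<open>Cones over a new apex\<close>

definition cone :: "'a \<Rightarrow> 'a set set \<Rightarrow> 'a set set" where
  "cone y \<Delta> = \<Delta> \<union> insert y ` \<Delta>"

text \<open>Since \<open>y\<close> is not a vertex of \<Delta>, the two pieces of the cone can be
  described by one condition without a case split on the apex.\<close>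

lemma mem_cone_iff:
  assumes "y \<notin> \<Union>\<Delta>"
  shows "\<tau> \<in> cone y \<Delta> \<longleftrightarrow> \<tau> - {y} \<in> \<Delta>"
proof
  assume "\<tau> \<in> cone y \<Delta>"
  then show "\<tau> - {y} \<in> \<Delta>"
    using assms by (auto simp: cone_def)
next
  assume "\<tau> - {y} \<in> \<Delta>"
  moreover have "\<tau> = \<tau> - {y} \<or> \<tau> = insert y (\<tau> - {y})"
    by blast
  ultimately show "\<tau> \<in> cone y \<Delta>"
    unfolding cone_def by (metis UnCI image_eqI)
qed

lemma simplicial_complex_cone:
  assumes "simplicial_complex \<Delta>" "y \<notin> \<Union>\<Delta>"
  shows "simplicial_complex (cone y \<Delta>)"
proof -
  have "\<sigma> - {y} \<in> \<Delta>" if "\<tau> - {y} \<in> \<Delta>" "\<sigma> \<subseteq> \<tau>" for \<sigma> \<tau>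
    using simplicial_complexD(3)[OF assms(1) that(1), of "\<sigma> - {y}"] that(2) by blast
  moreover have "finite (cone y \<Delta>)" "{} \<in> cone y \<Delta>"
    using simplicial_complexD(1,2)[OF assms(1)] by (auto simp: cone_def)
  ultimately show ?thesis
    unfolding simplicial_complex_def using mem_cone_iff[OF assms(2)] by blast
qed

text \<open>The apex can be added to any face of a cone, so a maximal face must contain it; what
  remains is maximal in the base.\<close>

lemma facets_coneD:
  assumes "y \<notin> \<Union>\<Delta>" "\<sigma> \<in> facets (cone y \<Delta>)"
  shows "y \<in> \<sigma>" "\<sigma> - {y} \<in> facets \<Delta>"
proof -
  have \<sigma>: "\<sigma> - {y} \<in> \<Delta>" and max: "\<And>\<tau>. \<tau> - {y} \<in> \<Delta> \<Longrightarrow> \<sigma> \<subseteq> \<tau> \<Longrightarrow> \<tau> = \<sigma>"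
    using assms(2) mem_cone_iff[OF assms(1)] by (auto simp: facets_def)
  show y: "y \<in> \<sigma>"
    using max[of "insert y \<sigma>"] \<sigma> by auto
  have "\<tau> = \<sigma> - {y}" if "\<tau> \<in> \<Delta>" "\<sigma> - {y} \<subseteq> \<tau>" for \<tau>
  proof -
    have "y \<notin> \<tau>"
      using that(1) assms(1) by blast
    then show ?thesis
      using max[of "insert y \<tau>"] that by auto
  qed
  then show "\<sigma> - {y} \<in> facets \<Delta>"
    using \<sigma> by (auto simp: facets_def)
qed

text \<open>Coning commutes with deletion and link at every vertex of the base, and a common facet
  of two cones with the same apex restricts to a common facet of the bases. Hence the shedding order
  of the base works for the cone.\<close>

lemma vertex_decomposable_cone:
  assumes "vertex_decomposable \<Delta>" "y \<notin> \<Union>\<Delta>"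
  shows "vertex_decomposable (cone y \<Delta>)"
  using assms
proof (induction rule: vertex_decomposable.induct)
  case (simplex \<Delta>)
  then obtain \<sigma> where "finite \<sigma>" "\<Delta> = Pow \<sigma>"
    by (auto simp: is_simplex_iff)
  then have "finite (insert y \<sigma>)" "cone y \<Delta> = Pow (insert y \<sigma>)"
    by (simp_all add: cone_def Pow_insert)
  then show ?case
    by (intro vertex_decomposable.simplex) (auto simp: is_simplex_iff)
next
  case (shedding \<Delta> v)
  have "v \<noteq> y"
    using shedding.hyps(2) shedding.prems by blast
  have y: "y \<notin> \<Union>(deletion \<Delta> v)" "y \<notin> \<Union>(link \<Delta> v)"
    using shedding.prems by (auto simp: deletion_def link_def)
  have del: "deletion (cone y \<Delta>) v = cone y (deletion \<Delta> v)"
    using \<open>v \<noteq> y\<close> by (auto simp: deletion_def cone_def)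
  have "insert v \<tau> - {y} = insert v (\<tau> - {y})" for \<tau>
    using \<open>v \<noteq> y\<close> by blast
  then have "\<tau> \<in> link (cone y \<Delta>) v \<longleftrightarrow> \<tau> \<in> cone y (link \<Delta> v)" for \<tau>
    using \<open>v \<noteq> y\<close> unfolding mem_cone_iff[OF y(2)]
    by (simp add: link_def mem_cone_iff[OF shedding.prems])
  then have lk: "link (cone y \<Delta>) v = cone y (link \<Delta> v)"
    by blast
  have "facets (cone y (deletion \<Delta> v)) \<inter> facets (cone y (link \<Delta> v)) = {}"
    using facets_coneD(2)[OF y(1)] facets_coneD(2)[OF y(2)] shedding.hyps(5) by blast
  moreover have "{v} \<in> cone y \<Delta>"
    using shedding.hyps(2) by (simp add: cone_def)
  ultimately show ?case
    using vertex_decomposable.shedding[OF simplicial_complex_cone[OF shedding.hyps(1) shedding.prems]]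
      shedding.IH y del lk by simp
qed

section \<open>Injective relabelling of vertices\<close>

lemma simplicial_complex_image:
  assumes "simplicial_complex \<Delta>"
  shows "simplicial_complex ((`) f ` \<Delta>)"
proof -
  have "\<sigma> \<in> (`) f ` \<Delta>" if \<tau>: "\<tau> \<in> \<Delta>" "\<sigma> \<subseteq> f ` \<tau>" for \<sigma> \<tau>
  proof -
    obtain \<rho> where "\<rho> \<subseteq> \<tau>" "\<sigma> = f ` \<rho>"
      using \<tau>(2) by (auto simp: subset_image_iff)
    then show ?thesis
      using simplicial_complexD(3)[OF assms \<tau>(1)] by blast
  qed
  moreover have "finite ((`) f ` \<Delta>)" "{} \<in> (`) f ` \<Delta>"
    using simplicial_complexD(1,2)[OF assms] by auto
  ultimately show ?thesis
    unfolding simplicial_complex_def by blast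
qed

lemma facets_image:
  assumes "inj_on f (\<Union>\<Delta>)"
  shows "facets ((`) f ` \<Delta>) \<subseteq> (`) f ` facets \<Delta>"
proof
  fix \<rho> assume "\<rho> \<in> facets ((`) f ` \<Delta>)"
  then obtain \<sigma> where \<sigma>: "\<sigma> \<in> \<Delta>" "\<rho> = f ` \<sigma>"
    and max: "\<And>\<tau>. \<tau> \<in> \<Delta> \<Longrightarrow> f ` \<sigma> \<subseteq> f ` \<tau> \<Longrightarrow> f ` \<tau> = f ` \<sigma>"
    by (auto simp: facets_def)
  have "\<tau> = \<sigma>" if "\<tau> \<in> \<Delta>" "\<sigma> \<subseteq> \<tau>" for \<tau>
    using max[OF that(1)] that \<sigma>(1) inj_on_image_eq_iff[OF assms, of \<tau> \<sigma>] by blast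
  then show "\<rho> \<in> (`) f ` facets \<Delta>"
    using \<sigma> by (auto simp: facets_def)
qed

lemma vertex_decomposable_image:
  assumes "vertex_decomposable \<Delta>" "inj_on f (\<Union>\<Delta>)"
  shows "vertex_decomposable ((`) f ` \<Delta>)"
  using assms
proof (induction rule: vertex_decomposable.induct)
  case (simplex \<Delta>)
  then obtain \<sigma> where "finite \<sigma>" "\<Delta> = Pow \<sigma>"
    by (auto simp: is_simplex_iff)
  then have "finite (f ` \<sigma>)" "(`) f ` \<Delta> = Pow (f ` \<sigma>)"
    by (simp_all add: image_Pow_surj)
  then show ?case
    by (intro vertex_decomposable.simplex) (auto simp: is_simplex_iff)
next
  case (shedding \<Delta> v)
  note inj = shedding.prems
  have v: "v \<in> \<Union>\<Delta>"
    using shedding.hyps(2) by blast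
  have mem: "f v \<in> f ` \<tau> \<longleftrightarrow> v \<in> \<tau>" if "\<tau> \<in> \<Delta>" for \<tau>
    using inj_on_image_mem_iff[OF inj v] that by blast
  have del: "deletion ((`) f ` \<Delta>) (f v) = (`) f ` deletion \<Delta> v"
    using mem by (auto simp: deletion_def)
  have face: "insert (f v) (f ` \<tau>) \<in> (`) f ` \<Delta> \<longleftrightarrow> insert v \<tau> \<in> \<Delta>" if "\<tau> \<in> \<Delta>" for \<tau>
  proof
    assume "insert (f v) (f ` \<tau>) \<in> (`) f ` \<Delta>"
    then obtain \<sigma> where \<sigma>: "\<sigma> \<in> \<Delta>" "f ` insert v \<tau> = f ` \<sigma>"
      by auto
    moreover have "insert v \<tau> \<subseteq> \<Union>\<Delta>" "\<sigma> \<subseteq> \<Union>\<Delta>"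
      using that \<sigma>(1) v by blast+
    ultimately show "insert v \<tau> \<in> \<Delta>"
      using inj_on_image_eq_iff[OF inj] by metis
  next
    assume "insert v \<tau> \<in> \<Delta>"
    then show "insert (f v) (f ` \<tau>) \<in> (`) f ` \<Delta>"
      by (metis image_eqI image_insert)
  qed
  have lk: "link ((`) f ` \<Delta>) (f v) = (`) f ` link \<Delta> v"
    using mem face by (auto simp: link_def)
  have inj': "inj_on f (\<Union>(deletion \<Delta> v))" "inj_on f (\<Union>(link \<Delta> v))"
    by (rule inj_on_subset[OF inj]; auto simp: deletion_def link_def)+
  \<comment> \<open>Injectivity on vertices makes the induced map on faces injective, so it keeps
    the disjoint sets of facets disjoint.\<close>
  have "inj_on ((`) f) \<Delta>"
    using inj_on_image[OF inj] .
  moreover have "facets (deletion \<Delta> v) \<subseteq> \<Delta>" "facets (link \<Delta> v) \<subseteq> \<Delta>"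
    by (auto simp: facets_def deletion_def link_def)
  ultimately have "(`) f ` facets (deletion \<Delta> v) \<inter> (`) f ` facets (link \<Delta> v) = {}"
    using shedding.hyps(5) by (metis image_empty inj_on_image_Int)
  then have disjoint: "facets ((`) f ` deletion \<Delta> v) \<inter> facets ((`) f ` link \<Delta> v) = {}"
    using Int_mono[OF facets_image[OF inj'(1)] facets_image[OF inj'(2)]] by (metis subset_empty)
  show ?case
  proof (rule vertex_decomposable.shedding)
    show "simplicial_complex ((`) f ` \<Delta>)"
      using simplicial_complex_image[OF shedding.hyps(1)] .
    show "{f v} \<in> (`) f ` \<Delta>"
      using image_eqI[of "{f v}" "(`) f" "{v}"] shedding.hyps(2) by simp
    show "vertex_decomposable (deletion ((`) f ` \<Delta>) (f v))"
      unfolding del using shedding.IH(1)[OF inj'(1)] .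
    show "vertex_decomposable (link ((`) f ` \<Delta>) (f v))"
      unfolding lk using shedding.IH(2)[OF inj'(2)] .
    show "facets (deletion ((`) f ` \<Delta>) (f v)) \<inter> facets (link ((`) f ` \<Delta>) (f v)) = {}"
      unfolding del lk using disjoint .
  qed
qed

section \<open>Whiskered complexes\<close>

text \<open>The preimage under \<open>Inl\<close> is the part of the face in \<Delta>; the preimage
  under \<open>Inr\<close> lists the vertices whose whisker ends are chosen. Allowing any \<Delta>
  lets deletions and links be whiskered again in the induction.\<close>

definition whisker_complex :: "'a set set \<Rightarrow> 'a set \<Rightarrow> ('a + 'a) set set" where
  "whisker_complex \<Delta> S =
     {\<tau>. Inl -` \<tau> \<in> \<Delta> \<and> Inr -` \<tau> \<subseteq> S \<and> Inl -` \<tau> \<inter> Inr -` \<tau> = {}}"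

text \<open>For \<mu> inside \<open>S\<close> this is the link of \<mu> restricted to the complement
  of \<open>S\<close>; disjointness from \<mu> is then automatic.\<close>

definition outer_link :: "'a set set \<Rightarrow> 'a set \<Rightarrow> 'a set \<Rightarrow> 'a set set" where
  "outer_link \<Delta> S \<mu> = {\<tau> \<in> \<Delta>. \<tau> \<inter> S = {} \<and> \<tau> \<union> \<mu> \<in> \<Delta>}"

lemma sum_set_eq: "\<tau> = Inl ` (Inl -` \<tau>) \<union> Inr ` (Inr -` \<tau>)"
proof -
  have "z \<in> \<tau> \<longleftrightarrow> z \<in> Inl ` (Inl -` \<tau>) \<union> Inr ` (Inr -` \<tau>)" for z
    by (cases z) auto
  then show ?thesis
    by blast
qed

lemma simplicial_complex_whisker_complex:
  assumes "simplicial_complex \<Delta>" "finite S"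
  shows "simplicial_complex (whisker_complex \<Delta> S)"
proof -
  \<comment> \<open>A face is determined by its two preimages, which bounds the number of
    faces.\<close>
  have "\<tau> \<in> (\<lambda>(a, b). Inl ` a \<union> Inr ` b) ` (\<Delta> \<times> Pow S)" if "\<tau> \<in> whisker_complex \<Delta> S" for \<tau>
  proof (rule image_eqI)
    show "\<tau> = (\<lambda>(a, b). Inl ` a \<union> Inr ` b) (Inl -` \<tau>, Inr -` \<tau>)"
      unfolding prod.case by (rule sum_set_eq)
    show "(Inl -` \<tau>, Inr -` \<tau>) \<in> \<Delta> \<times> Pow S"
      using that by (simp add: whisker_complex_def)
  qed
  then have "whisker_complex \<Delta> S \<subseteq> (\<lambda>(a, b). Inl ` a \<union> Inr ` b) ` (\<Delta> \<times> Pow S)"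
    by blast
  then have "finite (whisker_complex \<Delta> S)"
    using simplicial_complexD(1)[OF assms(1)] assms(2) by (meson finite_Pow_iff finite_SigmaI finite_imageI finite_subset)
  moreover have "\<sigma> \<in> whisker_complex \<Delta> S" if "\<tau> \<in> whisker_complex \<Delta> S" "\<sigma> \<subseteq> \<tau>" for \<sigma> \<tau>
    using that simplicial_complexD(3)[OF assms(1), of "Inl -` \<tau>" "Inl -` \<sigma>"]
    unfolding whisker_complex_def by blast
  moreover have "{} \<in> whisker_complex \<Delta> S"
    using simplicial_complexD(2)[OF assms(1)] by (simp add: whisker_complex_def)
  ultimately show ?thesis
    unfolding simplicial_complex_def by blast
qed

lemma whisker_complex_empty: "whisker_complex \<Delta> {} = (`) Inl ` \<Delta>"
proof -
  have "\<tau> \<in> whisker_complex \<Delta> {} \<longleftrightarrow> \<tau> \<in> (`) Inl ` \<Delta>" for \<tau>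
  proof
    assume "\<tau> \<in> whisker_complex \<Delta> {}"
    then have "Inl -` \<tau> \<in> \<Delta>" "Inr -` \<tau> = {}"
      by (auto simp: whisker_complex_def)
    then show "\<tau> \<in> (`) Inl ` \<Delta>"
      using sum_set_eq[of \<tau>] by (metis image_empty image_eqI sup_bot_right)
  next
    assume "\<tau> \<in> (`) Inl ` \<Delta>"
    then show "\<tau> \<in> whisker_complex \<Delta> {}"
      by (auto simp: whisker_complex_def inj_vimage_image_eq)
  qed
  then show ?thesis
    by blast
qed

text \<open>Once \<open>x\<close> is gone, nothing is incompatible with its whisker end, which
  therefore becomes a cone apex.\<close>

lemma deletion_whisker_complex:
  fixes x :: 'a
  assumes "x \<in> S"
  shows "deletion (whisker_complex \<Delta> S) (Inl x)
    = cone (Inr x) (whisker_complex (deletion \<Delta> x) (S - {x}))"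
proof -
  have apex: "Inr x \<notin> \<Union>(whisker_complex (deletion \<Delta> x) (S - {x}))"
    by (auto simp: whisker_complex_def)
  have "Inl -` (\<tau> - {Inr x}) = Inl -` \<tau>" "Inr -` (\<tau> - {Inr x}) = Inr -` \<tau> - {x}"
    for \<tau> :: "('a + 'a) set"
    by auto
  then have "\<tau> \<in> deletion (whisker_complex \<Delta> S) (Inl x) \<longleftrightarrow>
      \<tau> \<in> cone (Inr x) (whisker_complex (deletion \<Delta> x) (S - {x}))" for \<tau>
    unfolding mem_cone_iff[OF apex] using assms
    by (auto simp: whisker_complex_def deletion_def)
  then show ?thesis
    by blast
qed

text \<open>A face together with \<open>x\<close> cannot contain the whisker end of
  \<open>x\<close>, so only whiskers at \<open>S - {x}\<close> survive in the link.\<close>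

lemma link_whisker_complex:
  fixes x :: 'a
  assumes "x \<in> S"
  shows "link (whisker_complex \<Delta> S) (Inl x) = whisker_complex (link \<Delta> x) (S - {x})"
proof -
  have "Inl -` (insert (Inl x) \<tau>) = insert x (Inl -` \<tau>)" "Inr -` (insert (Inl x) \<tau>) = Inr -` \<tau>"
    for \<tau> :: "('a + 'a) set"
    by auto
  then have "\<tau> \<in> link (whisker_complex \<Delta> S) (Inl x) \<longleftrightarrow>
      \<tau> \<in> whisker_complex (link \<Delta> x) (S - {x})" for \<tau>
    using assms by (auto simp: whisker_complex_def link_def)
  then show ?thesis
    by blast
qed

lemma outer_link_deletion:
  assumes "x \<in> S" "\<mu> \<in> deletion \<Delta> x"
  shows "outer_link (deletion \<Delta> x) (S - {x}) \<mu> = outer_link \<Delta> S \<mu>"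
  using assms by (auto simp: outer_link_def deletion_def)

text \<open>With \<open>outer_link_deletion\<close> this splits the faces inside \<open>S\<close> by
  whether they contain \<open>x\<close>: those without it supply the hypotheses for the deletion,
  those with it the ones for the link.\<close>

lemma outer_link_link:
  assumes "simplicial_complex \<Delta>" "x \<in> S" "\<mu> \<in> link \<Delta> x"
  shows "outer_link (link \<Delta> x) (S - {x}) \<mu> = outer_link \<Delta> S (insert x \<mu>)"
proof -
  have "\<tau> \<in> outer_link (link \<Delta> x) (S - {x}) \<mu> \<longleftrightarrow> \<tau> \<in> outer_link \<Delta> S (insert x \<mu>)" for \<tau>
    using assms(2,3) simplicial_complexD(3)[OF assms(1), of "insert x (\<tau> \<union> \<mu>)"]
    by (auto simp: outer_link_def link_def)
  then show ?thesis
    by blast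
qed

text \<open>Induction on \<open>S\<close> with \<Delta> arbitrary, as the smaller set occurs with
  both the deletion and the link of \<Delta> at \<open>x\<close>.\<close>

lemma vertex_decomposable_whisker_complex:
  fixes S :: "'a set"
  assumes "finite S" "simplicial_complex \<Delta>"
    and "\<And>\<mu>. \<mu> \<in> \<Delta> \<Longrightarrow> \<mu> \<subseteq> S \<Longrightarrow> vertex_decomposable (outer_link \<Delta> S \<mu>)"
  shows "vertex_decomposable (whisker_complex \<Delta> S)"
  using assms
proof (induction S arbitrary: \<Delta> rule: finite_induct)
  case empty
  have "outer_link \<Delta> {} {} = \<Delta>"
    by (auto simp: outer_link_def)
  then have "vertex_decomposable \<Delta>"
    using empty.prems(2)[of "{}"] simplicial_complexD(2)[OF empty.prems(1)] by simp
  then show ?case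
    by (simp add: whisker_complex_empty vertex_decomposable_image)
next
  case (insert x S)
  note sc = insert.prems(1)
  let ?T = "insert x S"
  let ?W = "whisker_complex \<Delta> ?T"
  have T: "?T - {x} = S"
    using insert.hyps(2) by blast
  have sc_W: "simplicial_complex ?W"
    using simplicial_complex_whisker_complex[OF sc] insert.hyps(1) by blast
  have apex: "Inr x \<notin> \<Union>(whisker_complex \<Gamma> S)" for \<Gamma>
    using insert.hyps(2) by (auto simp: whisker_complex_def)
  have del: "deletion ?W (Inl x) = cone (Inr x) (whisker_complex (deletion \<Delta> x) S)"
    using deletion_whisker_complex[of x ?T \<Delta>] T by simp
  have "vertex_decomposable (outer_link (deletion \<Delta> x) S \<mu>)"
    if "\<mu> \<in> deletion \<Delta> x" "\<mu> \<subseteq> S" for \<mu>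
    using outer_link_deletion[of x ?T \<mu> \<Delta>] that T insert.prems(2)[of \<mu>]
    by (auto simp: deletion_def)
  then have "vertex_decomposable (whisker_complex (deletion \<Delta> x) S)"
    using insert.IH simplicial_complex_deletion[OF sc] by blast
  then have vd_del: "vertex_decomposable (deletion ?W (Inl x))"
    using vertex_decomposable_cone[OF _ apex] del by simp
  show ?case
  \<comment> \<open>In the induction \<Delta> may have lost the vertex \<open>x\<close>. Then the
    deletion is the whole whiskered complex, already known to be a vertex decomposable cone.\<close>
  proof (cases "{x} \<in> \<Delta>")
    case False
    then have "x \<notin> \<tau>" if "\<tau> \<in> \<Delta>" for \<tau>
      using simplicial_complexD(3)[OF sc that, of "{x}"] by blast
    then have "deletion ?W (Inl x) = ?W"
      by (auto simp: deletion_def whisker_complex_def)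
    then show ?thesis
      using vd_del by simp
  next
    case True
    have lk: "link ?W (Inl x) = whisker_complex (link \<Delta> x) S"
      using link_whisker_complex[of x ?T \<Delta>] T by simp
    have "vertex_decomposable (outer_link (link \<Delta> x) S \<mu>)"
      if "\<mu> \<in> link \<Delta> x" "\<mu> \<subseteq> S" for \<mu>
      using outer_link_link[OF sc, of x ?T \<mu>] that T insert.prems(2)[of "insert x \<mu>"]
      by (auto simp: link_def)
    then have "vertex_decomposable (link ?W (Inl x))"
      using insert.IH simplicial_complex_link[OF sc True] lk by simp
    moreover have "{Inl x} \<in> ?W"
    proof -
      have "Inl -` {Inl x :: 'a + 'a} = {x}" "Inr -` {Inl x :: 'a + 'a} = {}"
        by auto
      then show ?thesis
        using True by (simp add: whisker_complex_def)
    qed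
    \<comment> \<open>Every facet of the deletion contains the apex \<open>Inr x\<close>, and no
      face of the link does.\<close>
    moreover have "facets (deletion ?W (Inl x)) \<inter> facets (link ?W (Inl x)) = {}"
      using facets_coneD(1)[OF apex] apex[of "link \<Delta> x"] del lk by (auto simp: facets_def)
    ultimately show ?thesis
      using vertex_decomposable.shedding[OF sc_W] vd_del by blast
  qed
qed

lemma vertex_decomposable_outer_link:
  assumes sc: "simplicial_complex \<Delta>" and vd: "vertex_decomposable (whisker_complex \<Delta> S)"
    and \<mu>: "\<mu> \<in> \<Delta>" "\<mu> \<subseteq> S"
  shows "vertex_decomposable (outer_link \<Delta> S \<mu>)"
proof -
  \<comment> \<open>This face decides every whisker: it takes \<open>x\<close> for \<open>x\<close>
    in \<mu> and the whisker end otherwise. Each choice excludes the other endpoint, so its link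
    lives on the vertices outside \<open>S\<close>.\<close>
  let ?\<sigma> = "Inl ` \<mu> \<union> Inr ` (S - \<mu>)"
  have pre: "Inl -` ?\<sigma> = \<mu>" "Inr -` ?\<sigma> = S - \<mu>"
    by auto
  then have "?\<sigma> \<in> whisker_complex \<Delta> S"
    using \<mu> by (auto simp: whisker_complex_def)
  then have vd_link: "vertex_decomposable (face_link (whisker_complex \<Delta> S) ?\<sigma>)"
    using vertex_decomposable_face_link[OF vd] by blast
  have "\<tau> \<in> face_link (whisker_complex \<Delta> S) ?\<sigma> \<longleftrightarrow>
      \<tau> \<in> whisker_complex (outer_link \<Delta> S \<mu>) {}" for \<tau>
  proof -
    define A B where AB: "A = Inl -` \<tau>" "B = Inr -` \<tau>"
    have un: "Inl -` (\<tau> \<union> ?\<sigma>) = A \<union> \<mu>" "Inr -` (\<tau> \<union> ?\<sigma>) = B \<union> (S - \<mu>)"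
      unfolding vimage_Un[of _ \<tau>] pre AB by (rule refl)+
    \<comment> \<open>\<open>B\<close> must lie in \<mu> by its disjointness from
      \<open>S - \<mu>\<close>, yet also miss \<mu>, so it is empty; \<open>A\<close> misses both
      \<mu> and \<open>S - \<mu>\<close>.\<close>
    have sets: "B \<subseteq> S \<and> A \<inter> B = {} \<and> A \<inter> \<mu> = {} \<and> B \<inter> (S - \<mu>) = {} \<and>
        (A \<union> \<mu>) \<inter> (B \<union> (S - \<mu>)) = {} \<longleftrightarrow> A \<inter> S = {} \<and> B = {}"
      using \<mu>(2) by auto
    have "\<tau> \<inter> ?\<sigma> = {} \<longleftrightarrow> A \<inter> \<mu> = {} \<and> B \<inter> (S - \<mu>) = {}"
      by (auto simp: AB)
    then have "\<tau> \<in> face_link (whisker_complex \<Delta> S) ?\<sigma> \<longleftrightarrow>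
        A \<in> \<Delta> \<and> A \<union> \<mu> \<in> \<Delta> \<and> B \<subseteq> S \<and> A \<inter> B = {} \<and> A \<inter> \<mu> = {} \<and> B \<inter> (S - \<mu>) = {} \<and>
        (A \<union> \<mu>) \<inter> (B \<union> (S - \<mu>)) = {}"
      unfolding face_link_def whisker_complex_def mem_Collect_eq un AB[symmetric] by auto
    also have "\<dots> \<longleftrightarrow> A \<in> \<Delta> \<and> A \<union> \<mu> \<in> \<Delta> \<and> A \<inter> S = {} \<and> B = {}"
      unfolding sets by (rule refl)
    also have "\<dots> \<longleftrightarrow> \<tau> \<in> whisker_complex (outer_link \<Delta> S \<mu>) {}"
      unfolding whisker_complex_def outer_link_def mem_Collect_eq AB[symmetric] by auto
    finally show ?thesis .
  qed
  then have link_eq: "face_link (whisker_complex \<Delta> S) ?\<sigma> = whisker_complex (outer_link \<Delta> S \<mu>) {}"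
    by blast
  have "vertex_decomposable (whisker_complex (outer_link \<Delta> S \<mu>) {})"
    using vd_link unfolding link_eq .
  \<comment> \<open>With no whiskers left all vertices carry the tag \<open>Inl\<close>, so
    \<open>projl\<close> is a relabelling back to the original vertices.\<close>
  moreover have "inj_on projl (\<Union>(whisker_complex (outer_link \<Delta> S \<mu>) {}))"
    by (auto simp: whisker_complex_empty inj_on_def)
  ultimately have "vertex_decomposable ((`) projl ` whisker_complex (outer_link \<Delta> S \<mu>) {})"
    by (rule vertex_decomposable_image)
  then show ?thesis
    by (simp add: whisker_complex_empty image_image)
qed

section \<open>Independence complexes\<close>

text \<open>Edges copied from \<open>G\<close> constrain only the preimage under \<open>Inl\<close>,
  while the whisker edges make the two preimages disjoint.\<close>

lemma Ind_whisker:
  fixes G :: "'a sgraph"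
  shows "Ind (whisker G S) = whisker_complex (Ind G) S"
proof -
  have "\<tau> \<subseteq> Inl ` verts G \<union> Inr ` S \<longleftrightarrow> Inl -` \<tau> \<subseteq> verts G \<and> Inr -` \<tau> \<subseteq> S" for \<tau>
    by (subst sum_set_eq[of \<tau>]) auto
  moreover have "Inl ` e \<subseteq> \<tau> \<longleftrightarrow> e \<subseteq> Inl -` \<tau>" for e and \<tau> :: "('a + 'a) set"
    by auto
  moreover have "{Inl x, Inr x} \<subseteq> \<tau> \<longleftrightarrow> x \<in> Inl -` \<tau> \<inter> Inr -` \<tau>" for x and \<tau> :: "('a + 'a) set"
    by auto
  ultimately have "\<tau> \<in> Ind (whisker G S) \<longleftrightarrow> Inl -` \<tau> \<subseteq> verts G \<and> Inr -` \<tau> \<subseteq> S \<and>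
      (\<forall>e\<in>edges G. \<not> e \<subseteq> Inl -` \<tau>) \<and> (\<forall>x\<in>S. x \<notin> Inl -` \<tau> \<inter> Inr -` \<tau>)" for \<tau>
    unfolding Ind_def whisker_def
    by (simp only: mem_Collect_eq sgraph.simps ball_Un ball_simps conj_assoc)
  \<comment> \<open>Whisker edges exist only at \<open>S\<close>; this suffices for full
    disjointness because the chosen whisker ends belong to \<open>S\<close>.\<close>
  moreover have "(\<forall>x\<in>S. x \<notin> A \<inter> B) \<longleftrightarrow> A \<inter> B = {}" if "B \<subseteq> S" for A B
    using that by blast
  ultimately have "\<tau> \<in> Ind (whisker G S) \<longleftrightarrow> \<tau> \<in> whisker_complex (Ind G) S" for \<tau>
    by (simp only: whisker_complex_def Ind_def[of G] mem_Collect_eq conj_assoc cong: conj_cong)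
      argo
  then show ?thesis
    by blast
qed

lemma Ind_induced_subgraph_delete_closed_nbhd:
  assumes G: "fin_simple_graph G" and \<mu>: "\<mu> \<in> Ind G" "\<mu> \<subseteq> S"
  shows "Ind (induced_subgraph (delete_verts G (closed_nbhd G \<mu>)) (verts G - S))
    = outer_link (Ind G) S \<mu>" (is "?L = ?R")
proof
  show "?L \<subseteq> ?R"
  proof
    fix \<tau> assume "\<tau> \<in> ?L"
    then have sub: "\<tau> \<subseteq> verts G - closed_nbhd G \<mu> - S"
      and ind: "\<And>e. e \<in> edges G \<Longrightarrow> e \<inter> closed_nbhd G \<mu> = {} \<Longrightarrow>
          e \<subseteq> verts G - closed_nbhd G \<mu> - S \<Longrightarrow> \<not> e \<subseteq> \<tau>"
      unfolding Ind_def induced_subgraph_def delete_verts_def by auto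
    \<comment> \<open>An edge between \<tau> and \<mu> would put a vertex of \<tau> into the closed
      neighborhood. Any other edge within the union lies in \<tau>, where it survives in the induced
      subgraph, or in the independent set \<mu>.\<close>
    have no_edge: "\<not> e \<subseteq> \<tau> \<union> \<mu>" if e: "e \<in> edges G" for e
    proof
      assume cov: "e \<subseteq> \<tau> \<union> \<mu>"
      have "card e = 2"
        using G e by (auto simp: fin_simple_graph_def)
      then obtain a b where ab: "e = {a, b}"
        by (auto simp: card_2_iff)
      have False if "c \<in> \<tau>" "d \<in> \<mu>" "{c, d} \<in> edges G" for c d
        using that sub by (auto simp: closed_nbhd_def)
      then have "\<not> (a \<in> \<tau> \<and> b \<in> \<mu>)" "\<not> (b \<in> \<tau> \<and> a \<in> \<mu>)"
        using e unfolding ab by (metis insert_commute)+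
      then have "e \<subseteq> \<tau> \<or> e \<subseteq> \<mu>"
        using cov unfolding ab by blast
      moreover have "\<not> e \<subseteq> \<tau>"
        using ind[OF e] sub by blast
      moreover have "\<not> e \<subseteq> \<mu>"
        using \<mu>(1) e by (auto simp: Ind_def)
      ultimately show False
        by blast
    qed
    then have "\<tau> \<union> \<mu> \<in> Ind G"
      using sub \<mu>(1) by (auto simp: Ind_def)
    moreover have "\<tau> \<in> Ind G"
      using sub no_edge by (auto simp: Ind_def)
    ultimately show "\<tau> \<in> ?R"
      using sub by (auto simp: outer_link_def)
  qed
  show "?R \<subseteq> ?L"
  proof
    fix \<tau> assume "\<tau> \<in> ?R"
    then have \<tau>: "\<tau> \<in> Ind G" "\<tau> \<inter> S = {}" and un: "\<tau> \<union> \<mu> \<in> Ind G"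
      by (auto simp: outer_link_def)
    have "{x, y} \<notin> edges G" if "x \<in> \<tau>" "y \<in> \<mu>" for x y
      using un that by (auto simp: Ind_def)
    \<comment> \<open>Such an \<open>x\<close> is outside \<mu> because \<tau> avoids
      \<open>S\<close>, and it has no neighbor in \<mu> because the union is independent.\<close>
    then have "x \<notin> closed_nbhd G \<mu>" if "x \<in> \<tau>" for x
      using that \<tau>(2) \<mu>(2) by (auto simp: closed_nbhd_def)
    then show "\<tau> \<in> ?L"
      using \<tau> unfolding Ind_def induced_subgraph_def delete_verts_def by auto
  qed
qed

theorem theorem4p6:
  fixes G :: "'a sgraph" and S :: "'a set"
  assumes "fin_simple_graph G"
    and "S \<subseteq> verts G"
  shows "vertex_decomposable (Ind (whisker G S)) \<longleftrightarrow>
    (\<forall>\<mu>\<in>Ind G. \<mu> \<subseteq> S \<longrightarrow>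
       vertex_decomposable
         (Ind (induced_subgraph (delete_verts G (closed_nbhd G \<mu>)) (verts G - S))))"
proof -
  have sc: "simplicial_complex (Ind G)"
    using simplicial_complex_Ind[OF assms(1)] .
  have "finite S"
    using assms finite_subset by (auto simp: fin_simple_graph_def)
  then have "vertex_decomposable (whisker_complex (Ind G) S) \<longleftrightarrow>
      (\<forall>\<mu>\<in>Ind G. \<mu> \<subseteq> S \<longrightarrow> vertex_decomposable (outer_link (Ind G) S \<mu>))"
    using vertex_decomposable_whisker_complex[OF _ sc] vertex_decomposable_outer_link[OF sc]
    by metis
  then show ?thesis
    by (simp add: Ind_whisker Ind_induced_subgraph_delete_closed_nbhd[OF assms(1)])
qed

end
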